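(* Let $R_1=0.5828\dots$ be the root in $(0,1)$ of the equation $3y+2\log(1-y)=0$. Then for every $f(x)=\sum_{k=0}^{\infty}x^k a_k\in \mathcal{SRB}(\mathbb{B})$ (with $a_k\in\mathbb{O}$) and every $x\in\mathbb{B}$ with $|x|=r\le R_1$, $$\sum_{k=0}^{\infty}\frac{|x^k a_k|}{k+1}\le 1 .$$ The constant $R_1$ cannot be improved, i.e. for every $r\in(R_1,1)$ there exists $f\in\mathcal{SRB}(\mathbb{B})$ for which this inequality fails for $|x|=r$.
   Context: $\mathbb{O}$ is the real algebra of octonions, $\mathbb{O}=\mathbb{H}+l\mathbb{H}$ ($\mathbb{H}$ the quaternions) with $\overline{a+lb}=\overline a-lb$ and $(a+lb)(c+ld)=(ac-d\overline b)+l(\overline a d+cb)$, a non-commutative, non-associative, alternative division algebra. $|x|=\sqrt{x\overline x}$ is the Euclidean norm on $\mathbb{R}^8$; it is multiplicative. $\mathbb{B}=\{x\in\mathbb{O}:|x|<1\}$, $\mathbb{S}=\{I\in\mathbb{O}:I^2=-1\}$, and $\mathbb{D}$ is the open unit disk of $\mathbb{C}$. Slice regular functions on $\mathbb{B}$: a stem function on $\mathbb{D}$ is $F=F_1+iF_2:\mathbb{D}\to\mathbb{O}\otimes_{\mathbb{R}}\mathbb{C}$ with $\mathbb{O}$-valued components satisfying $F_1(\overline z)=F_1(z)$, $F_2(\overline z)=-F_2(z)$. It induces the slice function $f:\mathbb{B}\to\mathbb{O}$, $f(\alpha+I\beta)=F_1(\alpha+i\beta)+I F_2(\alpha+i\beta)$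 for $I\in\mathbb{S}$ and real $\alpha,\beta$ with $\alpha+i\beta\in\mathbb{D}$. The function $f$ is slice regular if $F$ is $C^1$ and satisfies the Cauchy–Riemann equations $\partial_\alpha F_1=\partial_\beta F_2$, $\partial_\beta F_1=-\partial_\alpha F_2$ on $\mathbb{D}$. Every slice regular function on $\mathbb{B}$ has a convergent power series expansion $f(x)=\sum_{k=0}^\infty x^k a_k$ with $a_k\in\mathbb{O}$. $\mathcal{SRB}(\mathbb{B})$ is the class of slice regular functions $f$ on $\mathbb{B}$ with $|f(x)|\le 1$ for all $x\in\mathbb{B}$. Convention: $x^0=1$. *)

theory Defs
  imports "HOL-Analysis.Analysis"
begin

datatype quat = Quat (qre: real) (qi: real) (qj: real) (qk: real)

lemma quat_eq_iff: "p = q \<longleftrightarrow> qre p = qre q \<and> qi p = qi q \<and> qj p = qj q \<and> qk p = qk q"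
  by (cases p; cases q) auto

instantiation quat :: ring_1
begin

definition "0 = Quat 0 0 0 0"
definition "1 = Quat 1 0 0 0"
definition "p + q = Quat (qre p + qre q) (qi p + qi q) (qj p + qj q) (qk p + qk q)"
definition "- p = Quat (- qre p) (- qi p) (- qj p) (- qk p)"
definition "p - q = Quat (qre p - qre q) (qi p - qi q) (qj p - qj q) (qk p - qk q)"
definition "p * q = Quat
  (qre p * qre q - qi p * qi q - qj p * qj q - qk p * qk q)
  (qre p * qi q + qi p * qre q + qj p * qk q - qk p * qj q)
  (qre p * qj q - qi p * qk q + qj p * qre q + qk p * qi q)
  (qre p * qk q + qi p * qj q - qj p * qi q + qk p * qre q)"

instance
  by standard
    (auto simp: quat_eq_iff zero_quat_def one_quat_def plus_quat_def uminus_quat_def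
       minus_quat_def times_quat_def algebra_simps)

end

lemma quat_sel [simp]:
  "qre 0 = 0" "qi 0 = 0" "qj 0 = 0" "qk 0 = 0"
  "qre 1 = 1" "qi 1 = 0" "qj 1 = 0" "qk 1 = 0"
  "qre (p + q) = qre p + qre q" "qi (p + q) = qi p + qi q"
  "qj (p + q) = qj p + qj q" "qk (p + q) = qk p + qk q"
  "qre (- p) = - qre p" "qi (- p) = - qi p" "qj (- p) = - qj p" "qk (- p) = - qk p"
  "qre (p - q) = qre p - qre q" "qi (p - q) = qi p - qi q"
  "qj (p - q) = qj p - qj q" "qk (p - q) = qk p - qk q"
  by (simp_all add: zero_quat_def one_quat_def plus_quat_def uminus_quat_def minus_quat_def)

lemma quat_times_sel:
  "qre (p * q) = qre p * qre q - qi p * qi q - qj p * qj q - qk p * qk q"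
  "qi (p * q) = qre p * qi q + qi p * qre q + qj p * qk q - qk p * qj q"
  "qj (p * q) = qre p * qj q - qi p * qk q + qj p * qre q + qk p * qi q"
  "qk (p * q) = qre p * qk q + qi p * qj q - qj p * qi q + qk p * qre q"
  by (simp_all add: times_quat_def)

instantiation quat :: real_vector
begin

definition "scaleR r p = Quat (r * qre p) (r * qi p) (r * qj p) (r * qk p)"

instance
  by standard (simp_all add: quat_eq_iff scaleR_quat_def algebra_simps)

end

instantiation quat :: real_inner
begin

definition "inner p q = qre p * qre q + qi p * qi q + qj p * qj q + qk p * qk q"
definition "norm (p :: quat) = sqrt (inner p p)"
definition "sgn (p :: quat) = p /\<^sub>R norm p"
definition "dist (p :: quat) q = norm (p - q)"
definition [code del]:
  "(uniformity :: (quat \<times> quat) filter) = (INF e\<in>{0<..}. principal {(x, y). dist x y < e})"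
definition [code del]:
  "open (U :: quat set) \<longleftrightarrow> (\<forall>x\<in>U. eventually (\<lambda>(x', y). x' = x \<longrightarrow> y \<in> U) uniformity)"

instance
proof
  fix p q s :: quat and r :: real
  show "inner p q = inner q p" "inner (p + q) s = inner p s + inner q s"
    "inner (r *\<^sub>R p) q = r * inner p q"
    by (simp_all add: inner_quat_def scaleR_quat_def algebra_simps)
  show "0 \<le> inner p p"
    by (simp add: inner_quat_def)
  show "inner p p = 0 \<longleftrightarrow> p = 0"
    by (auto simp: inner_quat_def quat_eq_iff add_nonneg_eq_0_iff)
qed (simp_all add: norm_quat_def sgn_quat_def dist_quat_def uniformity_quat_def open_quat_def)

end

definition qcnj :: "quat \<Rightarrow> quat" where
  "qcnj p = Quat (qre p) (- qi p) (- qj p) (- qk p)"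

text \<open>\<open>Oct a b\<close> stands for \<open>a + l b\<close>; the product below is the Cayley-Dickson rule
  \<open>(a + l b) (c + l d) = (a c - d b*) + l (a* d + c b)\<close>, where \<open>*\<close> is conjugation.\<close>

datatype octonion = Oct (oct1: quat) (oct2: quat)

lemma octonion_eq_iff: "x = y \<longleftrightarrow> oct1 x = oct1 y \<and> oct2 x = oct2 y"
  by (cases x; cases y) auto

instantiation octonion :: ab_group_add
begin

definition "0 = Oct 0 0"
definition "x + y = Oct (oct1 x + oct1 y) (oct2 x + oct2 y)"
definition "- x = Oct (- oct1 x) (- oct2 x)"
definition "x - y = Oct (oct1 x - oct1 y) (oct2 x - oct2 y)"

instance
  by standard
    (auto simp: octonion_eq_iff zero_octonion_def plus_octonion_def uminus_octonion_def
       minus_octonion_def algebra_simps)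

end

lemma octonion_sel [simp]:
  "oct1 0 = 0" "oct2 0 = 0"
  "oct1 (x + y) = oct1 x + oct1 y" "oct2 (x + y) = oct2 x + oct2 y"
  "oct1 (- x) = - oct1 x" "oct2 (- x) = - oct2 x"
  "oct1 (x - y) = oct1 x - oct1 y" "oct2 (x - y) = oct2 x - oct2 y"
  by (simp_all add: zero_octonion_def plus_octonion_def uminus_octonion_def minus_octonion_def)

text \<open>The multiplication is not associative, so the ring classes are not available. The class
  \<open>power\<close> needs only \<open>1\<close> and \<open>*\<close>; its powers satisfy \<open>x ^ 0 = 1\<close> and
  \<open>x ^ Suc n = x * x ^ n\<close>, and the bracketing is immaterial by alternativity.\<close>

instantiation octonion :: "{one, times}"
begin

definition "1 = Oct 1 0"
definition "x * y = Oct
  (oct1 x * oct1 y - oct2 y * qcnj (oct2 x))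
  (qcnj (oct1 x) * oct2 y + oct1 y * oct2 x)"

instance ..

end

instance octonion :: power ..

instantiation octonion :: real_vector
begin

definition "scaleR r x = Oct (r *\<^sub>R oct1 x) (r *\<^sub>R oct2 x)"

instance
  by standard (simp_all add: octonion_eq_iff scaleR_octonion_def algebra_simps)

end

instantiation octonion :: real_inner
begin

definition "inner x y = inner (oct1 x) (oct1 y) + inner (oct2 x) (oct2 y)"
definition "norm (x :: octonion) = sqrt (inner x x)"
definition "sgn (x :: octonion) = x /\<^sub>R norm x"
definition "dist (x :: octonion) y = norm (x - y)"
definition [code del]:
  "(uniformity :: (octonion \<times> octonion) filter) =
    (INF e\<in>{0<..}. principal {(x, y). dist x y < e})"
definition [code del]:
  "open (U :: octonion set) \<longleftrightarrow>
    (\<forall>x\<in>U. eventually (\<lambda>(x', y). x' = x \<longrightarrow> y \<in> U) uniformity)"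

instance
proof
  fix x y z :: octonion and r :: real
  show "inner x y = inner y x" "inner (x + y) z = inner x z + inner y z"
    "inner (r *\<^sub>R x) y = r * inner x y"
    by (simp_all add: inner_octonion_def scaleR_octonion_def inner_commute algebra_simps)
  show "0 \<le> inner x x"
    by (simp add: inner_octonion_def)
  show "inner x x = 0 \<longleftrightarrow> x = 0"
    by (auto simp: inner_octonion_def octonion_eq_iff add_nonneg_eq_0_iff)
qed (simp_all add: norm_octonion_def sgn_octonion_def dist_octonion_def
       uniformity_octonion_def open_octonion_def)

end

definition ocnj :: "octonion \<Rightarrow> octonion" where
  "ocnj x = Oct (qcnj (oct1 x)) (- oct2 x)"

lemma octonion_mult_cnj: "x * ocnj x = (norm x)\<^sup>2 *\<^sub>R (1 :: octonion)"
  by (simp add: power2_norm_eq_inner inner_octonion_def inner_quat_def ocnj_def qcnj_def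
      times_octonion_def one_octonion_def scaleR_octonion_def octonion_eq_iff quat_eq_iff
      quat_times_sel scaleR_quat_def algebra_simps)

text \<open>So the Euclidean norm of the class instance is the square root of \<open>x * ocnj x\<close>, as in the
  usual definition of the octonionic modulus.\<close>

lemma octonion_norm_mult: "norm (x * y) = norm x * norm (y :: octonion)"
proof -
  have "inner (x * y) (x * y) = inner x x * inner y y"
    by (simp add: inner_octonion_def inner_quat_def qcnj_def times_octonion_def quat_times_sel)
      algebra
  then show ?thesis
    by (simp add: norm_octonion_def real_sqrt_mult)
qed

definition imag_units :: "octonion set" where
  "imag_units = {I. I * I = - 1}"

definition partial_re :: "(complex \<Rightarrow> octonion) \<Rightarrow> complex \<Rightarrow> octonion" where
  "partial_re F z = vector_derivative (\<lambda>\<alpha>. F (Complex \<alpha> (Im z))) (at (Re z))"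

definition partial_im :: "(complex \<Rightarrow> octonion) \<Rightarrow> complex \<Rightarrow> octonion" where
  "partial_im F z = vector_derivative (\<lambda>\<beta>. F (Complex (Re z) \<beta>)) (at (Im z))"

definition C1_on_disc :: "(complex \<Rightarrow> octonion) \<Rightarrow> bool" where
  "C1_on_disc F \<longleftrightarrow>
    (\<forall>z\<in>ball 0 1. (\<lambda>\<alpha>. F (Complex \<alpha> (Im z))) differentiable at (Re z)
               \<and> (\<lambda>\<beta>. F (Complex (Re z) \<beta>)) differentiable at (Im z)) \<and>
    continuous_on (ball 0 1) (partial_re F) \<and> continuous_on (ball 0 1) (partial_im F)"

text \<open>A function with values in the complexified octonions is given by its two octonion-valued components.\<close>

definition stem_function :: "(complex \<Rightarrow> octonion) \<Rightarrow> (complex \<Rightarrow> octonion) \<Rightarrow> bool" where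
  "stem_function F1 F2 \<longleftrightarrow> (\<forall>z\<in>ball 0 1. F1 (cnj z) = F1 z \<and> F2 (cnj z) = - F2 z)"

definition induces_slice_function ::
    "(complex \<Rightarrow> octonion) \<Rightarrow> (complex \<Rightarrow> octonion) \<Rightarrow> (octonion \<Rightarrow> octonion) \<Rightarrow> bool" where
  "induces_slice_function F1 F2 f \<longleftrightarrow>
    (\<forall>I\<in>imag_units. \<forall>\<alpha> \<beta>. Complex \<alpha> \<beta> \<in> ball 0 1 \<longrightarrow>
      f (\<alpha> *\<^sub>R 1 + \<beta> *\<^sub>R I) = F1 (Complex \<alpha> \<beta>) + I * F2 (Complex \<alpha> \<beta>))"

definition cauchy_riemann_on_disc :: "(complex \<Rightarrow> octonion) \<Rightarrow> (complex \<Rightarrow> octonion) \<Rightarrow> bool" where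
  "cauchy_riemann_on_disc F1 F2 \<longleftrightarrow>
    (\<forall>z\<in>ball 0 1. partial_re F1 z = partial_im F2 z \<and> partial_im F1 z = - partial_re F2 z)"

definition slice_regular :: "(octonion \<Rightarrow> octonion) \<Rightarrow> bool" where
  "slice_regular f \<longleftrightarrow>
    (\<exists>F1 F2. stem_function F1 F2 \<and> C1_on_disc F1 \<and> C1_on_disc F2 \<and>
       cauchy_riemann_on_disc F1 F2 \<and> induces_slice_function F1 F2 f)"

definition SRB :: "(octonion \<Rightarrow> octonion) set" where
  "SRB = {f. slice_regular f \<and> (\<forall>x\<in>ball 0 1. norm (f x) \<le> 1)}"

definition has_expansion :: "(octonion \<Rightarrow> octonion) \<Rightarrow> (nat \<Rightarrow> octonion) \<Rightarrow> bool" where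
  "has_expansion f a \<longleftrightarrow> (\<forall>x\<in>ball 0 1. (\<lambda>k. x ^ k * a k) sums f x)"

definition is_R1 :: "real \<Rightarrow> bool" where
  "is_R1 y \<longleftrightarrow> 0 < y \<and> y < 1 \<and> 3 * y + 2 * ln (1 - y) = 0"

definition R1 :: real where
  "R1 = (THE y. is_R1 y)"

end

theory Submission
  imports Defs "HOL-Complex_Analysis.Riemann_Mapping"
begin

text \<open>The key is the estimate \<open>norm (a k) \<le> 1 - (norm (a 0))\<^sup>2\<close> for \<open>k > 0\<close>. A vector-valued
  holomorphic function bounded by 1 need not satisfy it, but here the slice can be adapted to
  \<open>k\<close>: choose an imaginary unit \<open>I\<close> such that \<open>a k\<close> lies on the left complex line
  \<open>\<complex>\<^sub>I (a 0)\<close>. The Hermitian coordinate along that line turns \<open>f\<close> into a scalar holomorphic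
  function on the disc, bounded by 1, whose coefficients 0 and \<open>k\<close> have the moduli of \<open>a 0\<close>
  and \<open>a k\<close>; averaging it over the \<open>k\<close>-th roots of unity and applying Schwarz--Pick at the
  origin gives the estimate.

  Writing \<open>L y = (\<Sum>k. y ^ k / (k + 1)) = - ln (1 - y) / y\<close>, the number \<open>R1\<close> is the point where the
  increasing function \<open>L\<close> takes the value \<open>3 / 2\<close>. With \<open>p = norm (a 0)\<close>, the sum at radius
  \<open>R1\<close> is at most \<open>p + (1 - p\<^sup>2) / 2 \<le> 1\<close>. Beyond \<open>R1\<close> the bound fails for the Moebius functions
  \<open>(x - t) / (1 - t x)\<close> with real \<open>t\<close> close to 1.\<close>

section \<open>The logarithmic series and the number \<open>R1\<close>\<close>

definition log_series :: "real \<Rightarrow> real" where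
  "log_series y = (\<Sum>k. y ^ k / real (k + 1))"

lemma summable_log_series:
  fixes y :: real
  assumes "0 \<le> y" "y < 1"
  shows "summable (\<lambda>k. y ^ k / real (k + 1))"
proof (rule summable_comparison_test')
  show "summable (\<lambda>k. y ^ k)"
    using assms by (intro summable_geometric) auto
  show "norm (y ^ k / real (k + 1)) \<le> y ^ k" for k
    using assms by (simp add: field_simps mult_le_cancel_left1)
qed

lemma log_series_eq_ln:
  assumes "0 < y" "y < 1"
  shows "log_series y = - ln (1 - y) / y"
proof -
  have "ln (1 - y) = (\<Sum>n. (-1) ^ n * (1 / real (n + 1)) * ((1 - y) - 1) ^ Suc n)"
    using assms by (intro ln_series) auto
  also have "\<dots> = (\<Sum>n. (- y) * (y ^ n / real (n + 1)))"
  proof (rule suminf_cong)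
    fix n
    have "((1 - y) - 1) ^ Suc n = - ((-1) ^ n * y ^ Suc n)"
      by (simp add: power_minus[of y])
    then show "(-1) ^ n * (1 / real (n + 1)) * ((1 - y) - 1) ^ Suc n
        = (- y) * (y ^ n / real (n + 1))"
      by (simp add: power_mult_distrib[symmetric] mult.assoc[symmetric])
  qed
  also have "\<dots> = - y * log_series y"
    unfolding log_series_def
    using assms by (intro suminf_mult summable_log_series) auto
  finally show ?thesis
    using assms by (simp add: field_simps)
qed

lemma log_series_strict_mono:
  assumes "0 \<le> x" "x < y" "y < 1"
  shows "log_series x < log_series y"
  unfolding log_series_def
proof -
  let ?d = "\<lambda>k. y ^ k / real (k + 1) - x ^ k / real (k + 1)"
  have sx: "summable (\<lambda>k. x ^ k / real (k + 1))"
    using assms by (intro summable_log_series) linarith+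
  have sy: "summable (\<lambda>k. y ^ k / real (k + 1))"
    using assms by (intro summable_log_series) linarith+
  have "0 < suminf ?d"
  proof (rule suminf_pos2[where i = 1])
    show "0 \<le> ?d k" for k
      using assms by (auto intro!: divide_right_mono power_mono)
  qed (use assms sx sy in \<open>auto intro: summable_diff\<close>)
  also have "suminf ?d = (\<Sum>k. y ^ k / real (k + 1)) - (\<Sum>k. x ^ k / real (k + 1))"
    using suminf_diff[OF sy sx] by simp
  finally show "(\<Sum>k. x ^ k / real (k + 1)) < (\<Sum>k. y ^ k / real (k + 1))"
    by simp
qed

text \<open>Division by \<open>2 * y\<close> recasts the equation as a level set of a strictly
  increasing function, which makes uniqueness immediate; \<open>3 * y + 2 * ln (1 - y)\<close>
  itself is not monotone on the unit interval.\<close>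

lemma is_R1_iff: "is_R1 y \<longleftrightarrow> 0 < y \<and> y < 1 \<and> log_series y = 3 / 2"
  by (auto simp: is_R1_def log_series_eq_ln field_simps)

text \<open>The arguments are \<open>1 - y\<close> and the bounds \<open>- 3 * y / 2\<close> for
  \<open>y = 0.5828\<close> and \<open>y = 0.5829\<close>, so \<open>3 * y + 2 * ln (1 - y)\<close>
  changes sign between these two points.\<close>

lemma ln_bounds_near_R1:
  "- (8742 / 10000) \<le> ln (4172 / 10000 :: real)" "ln (4171 / 10000 :: real) < - (87435 / 100000)"
proof -
  \<comment> \<open>The Lagrange remainder carries the even power \<open>x ^ 10\<close>, so the
    Taylor polynomial of degree 9 is a lower bound also at negative \<open>x\<close>.\<close>
  have exp_ge: "(\<Sum>m<10. x ^ m / fact m) \<le> exp x" for x :: real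
  proof -
    obtain t where "exp x = (\<Sum>m<10. x ^ m / fact m) + (exp t / fact 10) * x ^ 10"
      using Maclaurin_exp_le[of x 10] by blast
    then show ?thesis
      by simp
  qed
  have "10000 / 4172 \<le> (\<Sum>m<10. ((8742 / 10000)::real) ^ m / fact m)"
    by (simp add: lessThan_nat_numeral fact_numeral eval_nat_numeral)
  also have "\<dots> \<le> exp (8742 / 10000)"
    by (rule exp_ge)
  finally have "exp (- (8742 / 10000)) \<le> ((4172 / 10000) :: real)"
    by (simp add: exp_minus field_simps)
  then show "- (8742 / 10000) \<le> ln (4172 / 10000 :: real)"
    by (simp add: ln_ge_iff)
  have "((4171 / 10000)::real) < (\<Sum>m<10. (- (87435 / 100000)) ^ m / fact m)"
    by (simp add: lessThan_nat_numeral fact_numeral eval_nat_numeral)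
  also have "\<dots> \<le> exp (- (87435 / 100000))"
    by (rule exp_ge)
  finally have "(4171 / 10000) < exp (- (87435 / 100000) :: real)" .
  then show "ln (4171 / 10000 :: real) < - (87435 / 100000)"
    by (subst exp_less_cancel_iff[symmetric]) simp
qed

lemma ex1_is_R1: "\<exists>!y. is_R1 y"
  and R1_bounds: "is_R1 R1" "0.5828 \<le> R1" "R1 < 0.5829"
proof -
  have "\<exists>y\<ge>5828 / 10000. y \<le> 5829 / 10000 \<and> 3 * y + 2 * ln (1 - y) = (0::real)"
    using ln_bounds_near_R1 by (intro IVT2') (auto intro!: continuous_intros)
  then obtain y where y: "5828 / 10000 \<le> y" "y \<le> 5829 / 10000" "3 * y + 2 * ln (1 - y) = (0::real)"
    by blast
  then have y1: "is_R1 y"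
    by (auto simp: is_R1_def)
  have uniq: "z = y" if "is_R1 z" for z
    using that y1 log_series_strict_mono[of z y] log_series_strict_mono[of y z]
    by (fastforce simp: is_R1_iff)
  show "\<exists>!y. is_R1 y"
    using y1 uniq by blast
  have "R1 = y"
    unfolding R1_def using y1 uniq by blast
  \<comment> \<open>The intermediate value theorem yields a point of the closed interval; the strict
    logarithm bound excludes the right end.\<close>
  moreover have "y \<noteq> 5829 / 10000"
  proof
    assume y': "y = 5829 / 10000"
    then have "ln (1 - y) = ln (4171 / 10000)"
      by simp
    with y(3) y' ln_bounds_near_R1(2) show False
      by linarith
  qed
  ultimately show "is_R1 R1" "0.5828 \<le> R1" "R1 < 0.5829"
    using y y1 by auto
qed

section \<open>Coefficients of bounded holomorphic functions on the disc\<close>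

text \<open>Composition with the disc automorphism that moves the value at 0 to 0 makes the Schwarz
  lemma applicable and divides the derivative at 0 by one minus the squared modulus of that
  value.\<close>

lemma schwarz_pick_origin:
  fixes g :: "complex \<Rightarrow> complex"
  assumes hol: "g holomorphic_on ball 0 1" and le1: "\<And>z. cmod z < 1 \<Longrightarrow> cmod (g z) \<le> 1"
  shows "cmod (deriv g 0) \<le> 1 - (cmod (g 0))\<^sup>2"
proof -
  \<comment> \<open>\<open>g\<close> may attain modulus 1, so the Schwarz lemma is applied to \<open>t g\<close> and \<open>t\<close> tends to 1.\<close>
  have scaled: "t * cmod (deriv g 0) \<le> 1 - t\<^sup>2 * (cmod (g 0))\<^sup>2" if t: "0 < t" "t < 1" for t :: real
  proof -
    define w where "w = of_real t * g 0"
    define h where "h z = (of_real t * g z - w) / (1 - cnj w * (of_real t * g z))" for z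
    have lt1: "cmod (of_real t * g z) < 1" if "cmod z < 1" for z
    proof -
      have "t * cmod (g z) \<le> t * 1"
        using le1[OF that] t by (intro mult_left_mono) auto
      then have "t * cmod (g z) < 1"
        using t by linarith
      then show ?thesis
        using t by (simp add: norm_mult)
    qed
    have w1: "cmod w < 1"
      using lt1[of 0] by (simp add: w_def)
    have h_eq: "h = Moebius_function 0 w \<circ> (\<lambda>z. of_real t * g z)"
      by (auto simp: h_def Moebius_function_simple)
    have "h holomorphic_on ball 0 1"
      unfolding h_eq using lt1
      by (intro holomorphic_on_compose_gen[OF _ Moebius_function_holomorphic[OF w1]])
         (auto intro!: holomorphic_intros hol)
    moreover have "h 0 = 0"
      by (simp add: h_def w_def)
    moreover have "cmod (h z) < 1" if "cmod z < 1" for z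
      using Moebius_function_norm_lt_1[OF w1 lt1[OF that]] by (simp add: h_eq)
    ultimately have "cmod (deriv h 0) \<le> 1"
      by (intro Schwarz_Lemma(2)[where \<xi> = 0]) auto
    have w2: "1 - cnj w * w = of_real (1 - (cmod w)\<^sup>2)"
      unfolding of_real_diff complex_norm_square by simp
    have nz: "0 < 1 - (cmod w)\<^sup>2"
      using w1 by (simp add: abs_square_less_1)
    then have nz': "cnj w * w \<noteq> 1"
      using w2 by (metis diff_self less_irrefl of_real_eq_0_iff)
    have "(g has_field_derivative deriv g 0) (at 0)"
      using hol by (intro holomorphic_derivI[of g "ball 0 1"]) auto
    then have "(h has_field_derivative (of_real t * deriv g 0) / (1 - cnj w * w)) (at 0)"
      unfolding h_def
      by (auto intro!: derivative_eq_intros simp: w_def[symmetric] nz')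
    then have "deriv h 0 = (of_real t * deriv g 0) / (1 - cnj w * w)"
      by (rule DERIV_imp_deriv)
    then have "cmod (deriv h 0) = t * cmod (deriv g 0) / (1 - (cmod w)\<^sup>2)"
      using t nz by (simp only: w2 norm_divide norm_mult norm_of_real) simp
    with \<open>cmod (deriv h 0) \<le> 1\<close> nz have "t * cmod (deriv g 0) \<le> 1 - (cmod w)\<^sup>2"
      by (simp add: divide_le_eq)
    then show ?thesis
      using t by (simp add: w_def norm_mult power_mult_distrib)
  qed
  have "((\<lambda>t. t * cmod (deriv g 0)) \<longlongrightarrow> 1 * cmod (deriv g 0)) (at_left (1::real))"
    by (intro tendsto_intros)
  moreover have "((\<lambda>t. 1 - t\<^sup>2 * (cmod (g 0))\<^sup>2) \<longlongrightarrow> 1 - 1\<^sup>2 * (cmod (g 0))\<^sup>2) (at_left (1::real))"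
    by (intro tendsto_intros)
  moreover have "\<forall>\<^sub>F t in at_left (1::real). t * cmod (deriv g 0) \<le> 1 - t\<^sup>2 * (cmod (g 0))\<^sup>2"
    using eventually_at_left_real[OF zero_less_one] by eventually_elim (auto intro: scaled)
  ultimately show ?thesis
    using tendsto_le[of "at_left (1::real)"] by fastforce
qed

text \<open>For a primitive \<open>k\<close>-th root of unity, its \<open>n\<close>-th power is
  again a \<open>k\<close>-th root of unity, so the geometric sum of the powers of the latter
  vanishes unless it equals 1.\<close>

lemma sum_root_of_unity_powers:
  assumes "k > 0"
  shows "(\<Sum>j<k. (cis (2 * pi / real k) ^ j) ^ n) = (if k dvd n then of_nat k else 0)"
proof -
  define \<omega> where "\<omega> = cis (2 * pi / real k)"
  have "\<omega> ^ k = 1"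
    using assms by (simp only: \<omega>_def Complex.DeMoivre) simp
  have swap: "(\<Sum>j<k. (\<omega> ^ j) ^ n) = (\<Sum>j<k. (\<omega> ^ n) ^ j)"
    by (simp add: power_mult[symmetric] mult.commute)
  have one_iff: "\<omega> ^ n = 1 \<longleftrightarrow> k dvd n"
  proof
    assume "k dvd n"
    then show "\<omega> ^ n = 1"
      using \<open>\<omega> ^ k = 1\<close> by (auto simp: power_mult elim!: dvdE)
  next
    assume "\<omega> ^ n = 1"
    then have "cis (real n * (2 * pi / real k)) = 1"
      by (simp only: \<omega>_def Complex.DeMoivre)
    then have "cos (real n * (2 * pi / real k)) = 1"
      by (metis cis.sel(1) one_complex.sel(1))
    then obtain i :: int where "real n * (2 * pi / real k) = of_int i * 2 * pi"
      using cos_one_2pi_int by auto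
    then have "real n = of_int i * real k"
      using assms by (simp add: field_simps)
    then have "int n = i * int k"
      by (metis of_int_eq_iff of_int_mult of_int_of_nat_eq)
    then show "k dvd n"
      by (metis dvd_triv_right int_dvd_int_iff)
  qed
  show ?thesis
  proof (cases "k dvd n")
    case True
    then show ?thesis
      using swap one_iff by (simp add: \<omega>_def)
  next
    case False
    then have "\<omega> ^ n \<noteq> 1"
      using one_iff by simp
    then have "(\<Sum>j<k. (\<omega> ^ n) ^ j) = ((\<omega> ^ n) ^ k - 1) / (\<omega> ^ n - 1)"
      by (rule geometric_sum)
    also have "(\<omega> ^ n) ^ k = 1"
      using \<open>\<omega> ^ k = 1\<close> by (metis power_mult mult.commute power_one)
    finally show ?thesis
      using swap False by (simp add: \<omega>_def)
  qed
qed

text \<open>Averaging over rotations by \<open>k\<close>-th roots of unity keeps exactly the powers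
  of \<open>z ^ k\<close>. As a function of \<open>w = z ^ k\<close> the average is bounded by 1 and
  has value \<open>c 0\<close> and derivative \<open>c k\<close> at the origin.\<close>

lemma bounded_power_series_coeff:
  fixes g :: "complex \<Rightarrow> complex" and c :: "nat \<Rightarrow> complex"
  assumes sums: "\<And>z. cmod z < 1 \<Longrightarrow> (\<lambda>n. c n * z ^ n) sums g z"
    and le1: "\<And>z. cmod z < 1 \<Longrightarrow> cmod (g z) \<le> 1"
    and k: "k > 0"
  shows "cmod (c k) \<le> 1 - (cmod (c 0))\<^sup>2"
proof -
  define \<omega> where "\<omega> = cis (2 * pi / real k)"
  define G where "G w = (\<Sum>m. c (k * m) * w ^ m)" for w
  have norm_\<omega>: "cmod (\<omega> ^ j * z) = cmod z" for j z
    by (simp add: \<omega>_def norm_mult norm_power)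
  have avg: "(\<lambda>m. c (k * m) * (z ^ k) ^ m) sums ((\<Sum>j<k. g (\<omega> ^ j * z)) / of_nat k)"
    if z: "cmod z < 1" for z
  proof -
    have "(\<lambda>n. \<Sum>j<k. c n * (\<omega> ^ j * z) ^ n) sums (\<Sum>j<k. g (\<omega> ^ j * z))"
      using z by (intro sums_sum sums) (simp add: norm_\<omega>)
    moreover have "(\<Sum>j<k. c n * (\<omega> ^ j * z) ^ n) = c n * z ^ n * (\<Sum>j<k. (\<omega> ^ j) ^ n)" for n
      by (simp add: sum_distrib_left power_mult_distrib mult_ac)
    ultimately have "(\<lambda>n. c n * z ^ n * (if k dvd n then of_nat k else 0))
        sums (\<Sum>j<k. g (\<omega> ^ j * z))"
      by (simp only: \<omega>_def sum_root_of_unity_powers[OF k])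
    from sums_divide[OF this, of "of_nat k"]
    have "(\<lambda>n. c n * z ^ n * (if k dvd n then of_nat k else 0) / of_nat k)
        sums ((\<Sum>j<k. g (\<omega> ^ j * z)) / of_nat k)" .
    also have "(\<lambda>n. c n * z ^ n * (if k dvd n then of_nat k else 0) / of_nat k)
        = (\<lambda>n. if k dvd n then c n * z ^ n else 0)"
      using k by auto
    finally have S: "(\<lambda>n. if k dvd n then c n * z ^ n else 0)
        sums ((\<Sum>j<k. g (\<omega> ^ j * z)) / of_nat k)" .
    \<comment> \<open>Restricting the index to the multiples of \<open>k\<close> discards only zero
      terms.\<close>
    have "strict_mono (\<lambda>m. k * m)"
      using k by (auto simp: strict_mono_def)
    from sums_mono_reindex[OF this, THEN iffD2, OF _ S] show ?thesis
      by (simp add: power_mult image_def dvd_def)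
  qed
  \<comment> \<open>Surjectivity of the \<open>k\<close>-th power on the disc transfers convergence
    and the bound from the average at \<open>z\<close> to \<open>G\<close> at
    \<open>w\<close>.\<close>
  have root: "\<exists>z. cmod z < 1 \<and> z ^ k = w" if "cmod w < 1" for w
  proof (cases "w = 0")
    case True
    then show ?thesis
      using k by (intro exI[of _ 0]) auto
  next
    case False
    obtain z where z: "z ^ k = w"
      using k by (metis exists_complex_root not_gr_zero)
    moreover have "cmod z < 1"
      using that z k by (metis linorder_not_le norm_power one_le_power)
    ultimately show ?thesis
      by blast
  qed
  have Gsums: "(\<lambda>m. c (k * m) * w ^ m) sums G w" and G1: "cmod (G w) \<le> 1"
    if w: "cmod w < 1" for w
  proof -
    obtain z where z: "cmod z < 1" "z ^ k = w"
      using root[OF w] by blast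
    show s: "(\<lambda>m. c (k * m) * w ^ m) sums G w"
      using avg[OF z(1)] z(2) unfolding G_def by (auto simp: sums_iff)
    have "G w = (\<Sum>j<k. g (\<omega> ^ j * z)) / of_nat k"
      using sums_unique2[OF s] avg[OF z(1)] z(2) by simp
    moreover have "cmod (\<Sum>j<k. g (\<omega> ^ j * z)) \<le> (\<Sum>j<k. 1)"
      using z(1) by (intro sum_norm_le le1) (simp add: norm_\<omega>)
    ultimately show "cmod (G w) \<le> 1"
      using k by (simp add: norm_divide)
  qed
  have der: "(G has_field_derivative (\<Sum>n. diffs (\<lambda>m. c (k * m)) n * w ^ n)) (at w)"
    if "cmod w < 1" for w
    unfolding G_def[abs_def] using that Gsums
    by (intro termdiffs_strong'[where K = 1]) (auto simp: sums_iff)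
  have "\<exists>d. (G has_field_derivative d) (at w)" if "w \<in> ball 0 1" for w
    using der[of w] that by auto
  then have "G holomorphic_on ball 0 1"
    by (simp add: holomorphic_on_open)
  from schwarz_pick_origin[OF this G1]
  have "cmod (deriv G 0) \<le> 1 - (cmod (G 0))\<^sup>2"
    by simp
  moreover have "deriv G 0 = c k"
    using DERIV_imp_deriv[OF der[of 0]] by (simp add: diffs_def)
  moreover have "G 0 = c 0"
    by (simp add: G_def)
  ultimately show ?thesis
    by simp
qed

section \<open>Octonion identities and imaginary units\<close>

lemmas octonion_components = octonion_eq_iff quat_eq_iff times_octonion_def one_octonion_def
  scaleR_octonion_def scaleR_quat_def quat_times_sel qcnj_def inner_octonion_def inner_quat_def

lemma octonion_distrib:
  fixes x y z :: octonion
  shows "(x + y) * z = x * z + y * z" "x * (y + z) = x * y + x * z"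
    "(r *\<^sub>R x) * z = r *\<^sub>R (x * z)" "x * (r *\<^sub>R z) = r *\<^sub>R (x * z)"
    "1 * x = x" "x * 1 = x"
  by (simp_all add: octonion_components algebra_simps)

text \<open>The substitute for associativity that makes left multiplication by an imaginary unit
  square to minus the identity.\<close>

lemma octonion_left_alternative: "x * (x * y) = (x * x) * (y :: octonion)"
  by (simp add: octonion_components algebra_simps)

text \<open>Right division without associativity: for a unit \<open>u\<close>, every
  \<open>y\<close> is recovered from \<open>y * ocnj u\<close>.\<close>

lemma octonion_right_inverse: "(x * ocnj y) * y = (norm y)\<^sup>2 *\<^sub>R (x :: octonion)"
  by (simp add: power2_norm_eq_inner ocnj_def octonion_components algebra_simps)

text \<open>This quadratic equation ties \<open>I * I = - 1\<close> to geometry: imaginary units are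
  the unit vectors orthogonal to 1.\<close>

lemma octonion_square: "x * x = (2 * inner x 1) *\<^sub>R x - (norm x)\<^sup>2 *\<^sub>R (1 :: octonion)"
  by (simp add: power2_norm_eq_inner octonion_components algebra_simps)

lemma norm_octonion_one: "norm (1 :: octonion) = 1"
  by (simp add: norm_eq_sqrt_inner octonion_components)

text \<open>Left multiplication by \<open>I\<close> is a complex structure by alternativity and an
  isometry by multiplicativity of the norm. Polarisation gives preservation of inner products, and
  skewness follows from both facts.\<close>

lemma imag_unitsD:
  assumes "I \<in> imag_units"
  shows imag_units_norm: "norm I = 1"
    and imag_units_inner_one: "inner I 1 = 0"
    and imag_units_mult: "I * (I * x) = - x"
    and imag_units_inner: "inner (I * x) (I * y) = inner x y"
    and imag_units_inner_left: "inner (I * x) y = - inner x (I * y)"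
proof -
  have II: "I * I = - 1"
    using assms by (simp add: imag_units_def)
  have "norm I * norm I = 1"
    using octonion_norm_mult[of I I] II norm_octonion_one by simp
  then show n: "norm I = 1"
    by (metis abs_norm_cancel abs_mult_self_eq mult_cancel_right1 norm_ge_zero real_sqrt_abs2 real_sqrt_one)
  \<comment> \<open>With \<open>I * I = - 1\<close> and \<open>norm I = 1\<close> the constant terms
    of the quadratic equation cancel.\<close>
  have "(2 * inner I 1) *\<^sub>R I = 0"
    using octonion_square[of I] II n by simp
  with n show "inner I 1 = 0"
    by auto
  show m: "I * (I * x) = - x" for x
    using octonion_distrib(3)[of "-1" 1 x] by (simp add: octonion_left_alternative II octonion_distrib)
  show i: "inner (I * x) (I * y) = inner x y" for x y
  proof -
    have "norm (I * z) = norm z" for z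
      using n by (simp add: octonion_norm_mult)
    then show ?thesis
      unfolding dot_norm by (simp add: octonion_distrib(2)[symmetric])
  qed
  show "inner (I * x) y = - inner x (I * y)"
    using i[of x "I * y"] m[of y] by simp
qed

section \<open>Complex slices and Hermitian coordinates\<close>

definition slice_emb :: "octonion \<Rightarrow> complex \<Rightarrow> octonion" where
  "slice_emb I z = Re z *\<^sub>R 1 + Im z *\<^sub>R I"

lemma slice_emb_scaleR: "slice_emb I (of_real c * z) = c *\<^sub>R slice_emb I z"
  by (simp add: slice_emb_def scaleR_add_right)

lemma slice_emb_mult:
  assumes "I \<in> imag_units"
  shows "slice_emb I w * slice_emb I z = slice_emb I (w * z)"
  using assms by (simp add: slice_emb_def octonion_distrib imag_units_def algebra_simps)

lemma slice_emb_power: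
  assumes "I \<in> imag_units"
  shows "slice_emb I z ^ n = slice_emb I (z ^ n)"
proof (induction n)
  case 0
  then show ?case
    by (simp add: slice_emb_def)
next
  case (Suc n)
  then show ?case
    by (simp add: slice_emb_mult[OF assms])
qed

lemma norm_slice_emb:
  assumes "I \<in> imag_units"
  shows "norm (slice_emb I z) = cmod z"
proof -
  have "inner 1 (1 :: octonion) = 1" "inner I I = 1"
    using norm_octonion_one imag_units_norm[OF assms] by (simp_all add: norm_eq_1)
  then have "inner (slice_emb I z) (slice_emb I z) = (cmod z)\<^sup>2"
    using imag_units_inner_one[OF assms]
    unfolding cmod_power2 slice_emb_def
    by (simp add: inner_add_left inner_add_right inner_commute[of 1 I] power2_eq_square)
  then have "(norm (slice_emb I z))\<^sup>2 = (cmod z)\<^sup>2"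
    by (simp only: power2_norm_eq_inner)
  then show ?thesis
    by simp
qed

text \<open>The component of \<open>x\<close> orthogonal to 1 has a nonpositive real square, so if
  nonzero it normalises to an imaginary unit whose slice contains \<open>x\<close>.\<close>

lemma ex_slice_emb: "\<exists>I\<in>imag_units. \<exists>z. x = slice_emb I z"
proof -
  define v where "v = x - inner x 1 *\<^sub>R (1 :: octonion)"
  have "inner (1 :: octonion) 1 = 1"
    using norm_octonion_one by (simp add: norm_eq_1)
  then have "inner v 1 = 0"
    by (simp add: v_def inner_diff_left)
  then have v2: "v * v = - ((norm v)\<^sup>2 *\<^sub>R 1)"
    using octonion_square[of v] by simp
  show ?thesis
  proof (cases "v = 0")
    case True
    \<comment> \<open>For real \<open>x\<close> any imaginary unit serves; this one is the
      quaternion \<open>i\<close>.\<close>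
    have "Oct (Quat 0 1 0 0) 0 \<in> imag_units"
      by (simp add: imag_units_def octonion_components)
    moreover have "x = slice_emb (Oct (Quat 0 1 0 0) 0) (of_real (inner x 1))"
      using True by (simp add: slice_emb_def v_def)
    ultimately show ?thesis
      by blast
  next
    case False
    have "v /\<^sub>R norm v \<in> imag_units"
    proof -
      have "inverse (norm v) * (inverse (norm v) * (norm v)\<^sup>2) = 1"
        using False by (simp add: field_simps power2_eq_square)
      then show ?thesis
        using v2 by (simp add: imag_units_def octonion_distrib)
    qed
    moreover have "x = slice_emb (v /\<^sub>R norm v) (Complex (inner x 1) (norm v))"
      using False by (simp add: slice_emb_def v_def)
    ultimately show ?thesis
      by blast
  qed
qed

text \<open>The Hermitian coordinate along \<open>u\<close> for the complex structure
  \<open>x \<mapsto> I * x\<close>.\<close>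

definition slice_coord :: "octonion \<Rightarrow> octonion \<Rightarrow> octonion \<Rightarrow> complex" where
  "slice_coord I u x = Complex (inner x u) (inner x (I * u))"

text \<open>Complex linearity, from skewness and isometry of left multiplication by
  \<open>I\<close>. As coefficients stand to the right of the powers, an octonionic series on the
  slice becomes a scalar power series.\<close>

lemma slice_coord_mult:
  assumes "I \<in> imag_units"
  shows "slice_coord I u (slice_emb I z * x) = z * slice_coord I u x"
  using imag_units_inner_left[OF assms, of x u] imag_units_inner[OF assms, of x u]
  by (simp add: slice_coord_def slice_emb_def octonion_distrib inner_add_left complex_eq_iff)

lemma slice_coord_self:
  assumes "I \<in> imag_units" "norm u = 1"
  shows "slice_coord I u u = 1"
proof -
  have "inner (I * u) u = - inner u (I * u)"
    by (rule imag_units_inner_left[OF assms(1)])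
  then have "inner u (I * u) = 0"
    by (simp add: inner_commute)
  then show ?thesis
    using assms(2) by (simp add: slice_coord_def norm_eq_1 complex_eq_iff)
qed

lemma bounded_linear_slice_coord: "bounded_linear (slice_coord I u)"
proof -
  have "bounded_linear (\<lambda>x. of_real (inner x u) + \<i> * of_real (inner x (I * u)) :: complex)"
    by (intro bounded_linear_add bounded_linear_compose[OF bounded_linear_of_real bounded_linear_inner_left]
        bounded_linear_compose[OF bounded_linear_mult_right]
        bounded_linear_inner_left)
  then show ?thesis
    by (simp only: slice_coord_def[abs_def] Complex_eq)
qed

lemma norm_slice_coord_le:
  assumes I: "I \<in> imag_units" and u: "norm u = 1"
  shows "cmod (slice_coord I u x) \<le> norm x"
proof -
  define w where "w = slice_coord I u x"
  \<comment> \<open>\<open>p\<close> is the orthogonal projection of \<open>x\<close> to the complex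
    line of \<open>u\<close>; Cauchy--Schwarz against it gives the bound.\<close>
  define p where "p = slice_emb I w * u"
  have "inner x p = (cmod w)\<^sup>2"
    unfolding cmod_power2
    by (simp add: p_def slice_emb_def octonion_distrib inner_add_right w_def slice_coord_def
        power2_eq_square)
  moreover have "norm p = cmod w"
    by (simp add: p_def octonion_norm_mult u norm_slice_emb[OF I])
  ultimately have "(cmod w)\<^sup>2 \<le> norm x * cmod w"
    using norm_cauchy_schwarz[of x p] by simp
  then show ?thesis
    unfolding w_def[symmetric] by (cases "w = 0") (auto simp: power2_eq_square)
qed

section \<open>Slice regularity from holomorphic functions\<close>

text \<open>\<open>L\<close> will be the real or imaginary part times the octonion 1. It is only
  real-linear, so the factor \<open>\<i>\<close> of the second partial derivative stays inside
  it.\<close>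

lemma has_field_derivative_partial:
  assumes "(\<phi> has_field_derivative d) (at z)" "bounded_linear L"
  shows "((\<lambda>\<alpha>. L (\<phi> (Complex \<alpha> (Im z)))) has_vector_derivative L d) (at (Re z))"
    and "((\<lambda>\<beta>. L (\<phi> (Complex (Re z) \<beta>))) has_vector_derivative L (\<i> * d)) (at (Im z))"
proof -
  have "((\<lambda>\<alpha>. of_real \<alpha> + \<i> * of_real (Im z)) has_vector_derivative 1) (at (Re z))"
    "((\<lambda>\<beta>. of_real (Re z) + \<i> * of_real \<beta>) has_vector_derivative \<i>) (at (Im z))"
    by (auto intro!: derivative_eq_intros)
  moreover have "(\<phi> has_field_derivative d) (at (of_real (Re z) + \<i> * of_real (Im z)))"
    using assms(1) by (simp add: complex_eq[symmetric])
  ultimately have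
    "((\<lambda>\<alpha>. \<phi> (Complex \<alpha> (Im z))) has_vector_derivative d) (at (Re z))"
    "((\<lambda>\<beta>. \<phi> (Complex (Re z) \<beta>)) has_vector_derivative \<i> * d) (at (Im z))"
    using field_vector_diff_chain_at[of _ _ _ \<phi> d]
    by (fastforce simp: o_def complex_eq[symmetric] Complex_eq)+
  then show "((\<lambda>\<alpha>. L (\<phi> (Complex \<alpha> (Im z)))) has_vector_derivative L d) (at (Re z))"
    and "((\<lambda>\<beta>. L (\<phi> (Complex (Re z) \<beta>))) has_vector_derivative L (\<i> * d)) (at (Im z))"
    by (auto intro: bounded_linear.has_vector_derivative[OF assms(2)])
qed

lemma C1_on_disc_holomorphic:
  assumes hol: "\<phi> holomorphic_on ball 0 1" and L: "bounded_linear L"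
  shows "C1_on_disc (\<lambda>z. L (\<phi> z))"
    and "z \<in> ball 0 1 \<Longrightarrow> partial_re (\<lambda>z. L (\<phi> z)) z = L (deriv \<phi> z)"
    and "z \<in> ball 0 1 \<Longrightarrow> partial_im (\<lambda>z. L (\<phi> z)) z = L (\<i> * deriv \<phi> z)"
proof -
  have "(\<phi> has_field_derivative deriv \<phi> z) (at z)" if "z \<in> ball 0 1" for z
    using that hol by (intro holomorphic_derivI) auto
  note d = has_field_derivative_partial[OF this L]
  show re: "partial_re (\<lambda>z. L (\<phi> z)) z = L (deriv \<phi> z)" if "z \<in> ball 0 1" for z
    unfolding partial_re_def using d(1)[OF that] by (rule vector_derivative_at)
  show im: "partial_im (\<lambda>z. L (\<phi> z)) z = L (\<i> * deriv \<phi> z)" if "z \<in> ball 0 1" for z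
    unfolding partial_im_def using d(2)[OF that] by (rule vector_derivative_at)
  have cont: "continuous_on (ball 0 1) (deriv \<phi>)"
    using hol by (intro holomorphic_on_imp_continuous_on holomorphic_deriv) auto
  have "continuous_on (ball 0 1) (\<lambda>z. L (deriv \<phi> z))"
    "continuous_on (ball 0 1) (\<lambda>z. L (\<i> * deriv \<phi> z))"
    by (intro bounded_linear.continuous_on[OF L] continuous_intros cont)+
  then have "continuous_on (ball 0 1) (partial_re (\<lambda>z. L (\<phi> z)))"
    "continuous_on (ball 0 1) (partial_im (\<lambda>z. L (\<phi> z)))"
    by (auto elim: continuous_on_eq simp: re im)
  moreover have "(\<lambda>\<alpha>. L (\<phi> (Complex \<alpha> (Im z)))) differentiable at (Re z)"
    "(\<lambda>\<beta>. L (\<phi> (Complex (Re z) \<beta>))) differentiable at (Im z)" if "z \<in> ball 0 1" for z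
    using d[OF that] by (blast intro: differentiableI_vector)+
  ultimately show "C1_on_disc (\<lambda>z. L (\<phi> z))"
    unfolding C1_on_disc_def by blast
qed

text \<open>The real and imaginary parts of \<open>\<phi>\<close>, times 1, form the stem function:
  symmetry under conjugation gives its parity, and the complex derivative its Cauchy--Riemann
  equations.\<close>

lemma slice_regular_holomorphic:
  assumes hol: "\<phi> holomorphic_on ball 0 1"
    and sym: "\<And>z. cmod z < 1 \<Longrightarrow> \<phi> (cnj z) = cnj (\<phi> z)"
    and f: "\<And>I z. I \<in> imag_units \<Longrightarrow> cmod z < 1 \<Longrightarrow> f (slice_emb I z) = slice_emb I (\<phi> z)"
  shows "slice_regular f"
proof -
  define F1 :: "complex \<Rightarrow> octonion" where "F1 z = Re (\<phi> z) *\<^sub>R 1" for z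
  define F2 :: "complex \<Rightarrow> octonion" where "F2 z = Im (\<phi> z) *\<^sub>R 1" for z
  have L: "bounded_linear (\<lambda>w. Re w *\<^sub>R (1 :: octonion))" "bounded_linear (\<lambda>w. Im w *\<^sub>R (1 :: octonion))"
    by (intro bounded_linear_compose[OF bounded_linear_scaleR_left]
        bounded_linear_Re bounded_linear_Im)+
  note C1 = C1_on_disc_holomorphic[OF hol L(1), folded F1_def[abs_def]]
    C1_on_disc_holomorphic[OF hol L(2), folded F2_def[abs_def]]
  have "stem_function F1 F2"
    by (auto simp: stem_function_def F1_def F2_def sym)
  moreover have "cauchy_riemann_on_disc F1 F2"
    by (auto simp: cauchy_riemann_on_disc_def C1)
  moreover have "induces_slice_function F1 F2 f"
    using f[of _ "Complex _ _"]
    by (auto simp: induces_slice_function_def F1_def F2_def slice_emb_def octonion_distrib)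
  ultimately show ?thesis
    unfolding slice_regular_def using C1 by blast
qed

section \<open>The coefficient estimate and the Bohr inequality\<close>

text \<open>With \<open>u\<close> the direction of \<open>x\<close>, the vector \<open>x\<close> is
  a real multiple of \<open>u\<close> and lies on its complex line for every \<open>I\<close>. Hence
  \<open>I\<close> is still free and can be taken so that its slice contains
  \<open>y * ocnj u\<close>.\<close>

lemma common_slice_line:
  obtains I u z w where "I \<in> imag_units" "norm u = 1"
    "x = slice_emb I z * u" "y = slice_emb I w * u"
proof -
  define u where "u = (if x = 0 then 1 else sgn x)"
  have u: "norm u = 1" "x = norm x *\<^sub>R u"
    by (auto simp: u_def norm_octonion_one norm_sgn sgn_div_norm)
  obtain I w where I: "I \<in> imag_units" and w: "y * ocnj u = slice_emb I w"
    using ex_slice_emb by blast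
  have "x = slice_emb I (of_real (norm x)) * u"
    using u(2) by (simp add: slice_emb_def octonion_distrib)
  moreover have "y = slice_emb I w * u"
    using octonion_right_inverse[of y u] by (simp add: w u(1))
  ultimately show thesis
    using that I u(1) by blast
qed

lemma coeff_norm_le:
  assumes exp: "has_expansion f a" and le1: "\<And>x. norm x < 1 \<Longrightarrow> norm (f x) \<le> 1"
    and k: "k > 0"
  shows "norm (a k) \<le> 1 - (norm (a 0))\<^sup>2"
proof -
  obtain I u z w where I: "I \<in> imag_units" and u: "norm u = 1"
    and zw: "a 0 = slice_emb I z * u" "a k = slice_emb I w * u"
    by (rule common_slice_line)
  define c where "c n = slice_coord I u (a n)" for n
  have c: "c 0 = z" "c k = w"
    by (simp_all add: c_def zw slice_coord_mult[OF I] slice_coord_self[OF I u])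
  have "cmod (c k) \<le> 1 - (cmod (c 0))\<^sup>2"
  proof (rule bounded_power_series_coeff[OF _ _ k])
    fix \<zeta> :: complex
    assume "cmod \<zeta> < 1"
    then have \<zeta>: "norm (slice_emb I \<zeta>) < 1"
      by (simp add: norm_slice_emb[OF I])
    then have "(\<lambda>n. slice_emb I \<zeta> ^ n * a n) sums f (slice_emb I \<zeta>)"
      using exp by (simp add: has_expansion_def)
    from bounded_linear.sums[OF bounded_linear_slice_coord this, of I u]
    show "(\<lambda>n. c n * \<zeta> ^ n) sums slice_coord I u (f (slice_emb I \<zeta>))"
      by (simp add: slice_emb_power[OF I] slice_coord_mult[OF I] c_def mult.commute)
    show "cmod (slice_coord I u (f (slice_emb I \<zeta>))) \<le> 1"
      using norm_slice_coord_le[OF I u] le1[OF \<zeta>] by (rule order_trans)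
  qed
  then show ?thesis
    by (simp add: c zw octonion_norm_mult norm_slice_emb[OF I] u)
qed

lemma octonion_norm_power: "norm (x ^ n) = norm (x :: octonion) ^ n"
  by (induction n) (simp_all add: norm_octonion_one octonion_norm_mult)

lemma bohr_inequality:
  assumes exp: "has_expansion f a" and le1: "\<And>x. norm x < 1 \<Longrightarrow> norm (f x) \<le> 1"
    and x: "norm x \<le> R1"
  shows "summable (\<lambda>k. norm (x ^ k * a k) / real (k + 1))"
    and "(\<Sum>k. norm (x ^ k * a k) / real (k + 1)) \<le> 1"
proof -
  define p where "p = norm (a 0)"
  have coeff: "norm (a k) \<le> 1 - p\<^sup>2" if "k > 0" for k
    unfolding p_def using coeff_norm_le[OF exp le1 that] .
  have p2: "0 \<le> 1 - p\<^sup>2"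
    using coeff[of 1] norm_ge_zero[of "a 1"] by linarith
  have R1: "0 < R1" "R1 < 1" "log_series R1 = 3 / 2"
    using R1_bounds(1) by (auto simp: is_R1_iff)
  \<comment> \<open>The first summand uses the bound \<open>1 - p\<^sup>2\<close> for all indices;
    the second restores the true value \<open>p\<close> at index 0.\<close>
  define b where "b k = (1 - p\<^sup>2) * (R1 ^ k / real (k + 1)) + (if k = 0 then p - (1 - p\<^sup>2) else 0)" for k
  have "(\<lambda>k. R1 ^ k / real (k + 1)) sums (3 / 2)"
    using summable_log_series[of R1] R1 by (simp add: log_series_def sums_iff)
  then have "b sums ((1 - p\<^sup>2) * (3 / 2) + (p - (1 - p\<^sup>2)))"
    unfolding b_def by (intro sums_add sums_mult sums_single)
  \<comment> \<open>The value \<open>3 / 2\<close> of \<open>log_series\<close> at \<open>R1\<close>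
    is exactly what leaves 1 minus half a square.\<close>
  also have "(1 - p\<^sup>2) * (3 / 2) + (p - (1 - p\<^sup>2)) = 1 - (1 - p)\<^sup>2 / 2"
    by (simp add: power2_eq_square field_simps)
  finally have b: "b sums (1 - (1 - p)\<^sup>2 / 2)" .
  have le_b: "norm (x ^ k * a k) / real (k + 1) \<le> b k" for k
  proof (cases "k = 0")
    case True
    then show ?thesis
      by (simp add: b_def p_def octonion_distrib)
  next
    case False
    have "norm x ^ k * norm (a k) \<le> R1 ^ k * (1 - p\<^sup>2)"
      using False coeff p2 x R1 by (intro mult_mono power_mono) auto
    then have "norm x ^ k * norm (a k) / real (k + 1) \<le> R1 ^ k * (1 - p\<^sup>2) / real (k + 1)"
      by (rule divide_right_mono) simp
    then show ?thesis
      using False by (simp add: b_def octonion_norm_mult octonion_norm_power mult.commute)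
  qed
  show s: "summable (\<lambda>k. norm (x ^ k * a k) / real (k + 1))"
    using le_b by (intro summable_comparison_test'[OF sums_summable[OF b], of 0]) auto
  have "(\<Sum>k. norm (x ^ k * a k) / real (k + 1)) \<le> suminf b"
    by (intro suminf_le le_b s sums_summable[OF b])
  also have "\<dots> = 1 - (1 - p)\<^sup>2 / 2"
    using b by (simp add: sums_iff)
  finally show "(\<Sum>k. norm (x ^ k * a k) / real (k + 1)) \<le> 1"
    using zero_le_power2[of "1 - p"] by linarith
qed

section \<open>Sharpness: the Moebius functions\<close>

text \<open>Taylor coefficients of \<open>(z - t) / (1 - t * z)\<close>: \<open>- t\<close> at index
  0, then \<open>(1 - t\<^sup>2) * t ^ (k - 1)\<close>. This form is a geometric sequence with a
  correction at index 0.\<close>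

definition moebius_coeff :: "real \<Rightarrow> nat \<Rightarrow> real" where
  "moebius_coeff t k = (1 - t\<^sup>2) / t * t ^ k - (if k = 0 then 1 / t else 0)"

lemma moebius_coeff_sums:
  assumes t: "0 < t" "t < 1" and z: "cmod z < 1"
  shows "(\<lambda>k. of_real (moebius_coeff t k) * z ^ k) sums Moebius_function 0 (of_real t) z"
proof -
  have tz: "cmod (of_real t * z) < 1"
    using t z mult_strict_mono[of t 1 "cmod z" 1] by (simp add: norm_mult)
  then have nz: "1 - of_real t * z \<noteq> 0"
    by auto
  \<comment> \<open>Partial fractions: the Moebius function is a multiple of
    \<open>1 / (1 - t * z)\<close> minus the constant \<open>1 / t\<close>.\<close>
  have "(\<lambda>k. of_real ((1 - t\<^sup>2) / t) * (of_real t * z) ^ k - (if k = 0 then of_real (1 / t) else 0))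
      sums (of_real ((1 - t\<^sup>2) / t) * (1 / (1 - of_real t * z)) - of_real (1 / t))"
    by (intro sums_diff sums_mult geometric_sums tz sums_single)
  also have "(\<lambda>k. of_real ((1 - t\<^sup>2) / t) * (of_real t * z) ^ k - (if k = 0 then of_real (1 / t) else 0))
      = (\<lambda>k. of_real (moebius_coeff t k) * z ^ k)"
    by (auto simp: moebius_coeff_def power_mult_distrib algebra_simps)
  also have "of_real ((1 - t\<^sup>2) / t) * (1 / (1 - of_real t * z)) - of_real (1 / t)
      = Moebius_function 0 (of_real t) z"
    using t nz by (simp add: Moebius_function_simple divide_simps) (simp add: power2_eq_square algebra_simps)
  finally show ?thesis .
qed

text \<open>The coefficients are real, so the series maps each slice into itself and acts there as
  the complex Moebius function, which gives regularity and the bound.\<close>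

lemma moebius_SRB:
  assumes t: "0 < t" "t < 1"
  obtains f where "f \<in> SRB" "has_expansion f (\<lambda>k. moebius_coeff t k *\<^sub>R 1)"
proof -
  define \<phi> where "\<phi> = Moebius_function 0 (of_real t)"
  define f where "f x = (\<Sum>k. x ^ k * (moebius_coeff t k *\<^sub>R 1))" for x :: octonion
  have sums: "(\<lambda>k. slice_emb I z ^ k * (moebius_coeff t k *\<^sub>R 1)) sums slice_emb I (\<phi> z)"
    if "I \<in> imag_units" "cmod z < 1" for I z
  proof -
    have "bounded_linear (slice_emb I)"
      unfolding slice_emb_def[abs_def]
      by (intro bounded_linear_add bounded_linear_compose[OF bounded_linear_scaleR_left]
          bounded_linear_Re bounded_linear_Im)
    from bounded_linear.sums[OF this moebius_coeff_sums[OF t that(2)]]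
    show ?thesis
      by (simp add: slice_emb_power[OF that(1)] slice_emb_scaleR octonion_distrib \<phi>_def)
  qed
  then have f: "f (slice_emb I z) = slice_emb I (\<phi> z)" if "I \<in> imag_units" "cmod z < 1" for I z
    unfolding f_def using that by (simp add: sums_iff)
  have "slice_regular f"
  proof (rule slice_regular_holomorphic[OF _ _ f])
    show "\<phi> holomorphic_on ball 0 1"
      unfolding \<phi>_def using t by (intro Moebius_function_holomorphic) simp
    show "\<phi> (cnj z) = cnj (\<phi> z)" for z
      by (simp add: \<phi>_def Moebius_function_simple)
  qed
  moreover have "norm (f x) \<le> 1" if x: "norm x < 1" for x
  proof -
    obtain I z where I: "I \<in> imag_units" and z: "x = slice_emb I z"
      using ex_slice_emb by blast
    with x have "cmod z < 1"
      by (simp add: norm_slice_emb)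
    moreover from this have "cmod (\<phi> z) < 1"
      unfolding \<phi>_def using t by (intro Moebius_function_norm_lt_1) auto
    ultimately show ?thesis
      using I by (simp add: z f norm_slice_emb)
  qed
  ultimately have "f \<in> SRB"
    by (simp add: SRB_def)
  moreover have "has_expansion f (\<lambda>k. moebius_coeff t k *\<^sub>R 1)"
    unfolding has_expansion_def
  proof
    fix x :: octonion
    assume "x \<in> ball 0 1"
    moreover obtain I z where I: "I \<in> imag_units" and z: "x = slice_emb I z"
      using ex_slice_emb by blast
    ultimately have "cmod z < 1"
      by (simp add: norm_slice_emb)
    then show "(\<lambda>k. x ^ k * (moebius_coeff t k *\<^sub>R 1)) sums f x"
      using sums[OF I] f[OF I] by (simp add: z)
  qed
  ultimately show thesis
    using that by blast
qed

lemma moebius_bohr_sums: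
  assumes t: "0 < t" "t < 1" and r: "0 \<le> r" "r < 1" and x: "norm (x :: octonion) = r"
  shows "(\<lambda>k. norm (x ^ k * (moebius_coeff t k *\<^sub>R 1)) / real (k + 1))
    sums (t + (1 - t\<^sup>2) / t * (log_series (t * r) - 1))"
proof -
  have t2: "t\<^sup>2 < 1"
    using t by (simp add: abs_square_less_1)
  have "t * r < 1"
    using t r mult_strict_mono[of t 1 r 1] by simp
  then have "(\<lambda>k. (t * r) ^ k / real (k + 1)) sums log_series (t * r)"
    using summable_log_series[of "t * r"] t r by (simp add: log_series_def sums_iff)
  \<comment> \<open>The coefficient at index 0 has modulus \<open>t\<close>, while the geometric
    pattern would give \<open>(1 - t\<^sup>2) / t\<close>; the last summand corrects this.\<close>
  then have "(\<lambda>k. (1 - t\<^sup>2) / t * ((t * r) ^ k / real (k + 1)) + (if k = 0 then t - (1 - t\<^sup>2) / t else 0))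
      sums ((1 - t\<^sup>2) / t * log_series (t * r) + (t - (1 - t\<^sup>2) / t))"
    by (intro sums_add sums_mult sums_single)
  also have "(\<lambda>k. (1 - t\<^sup>2) / t * ((t * r) ^ k / real (k + 1)) + (if k = 0 then t - (1 - t\<^sup>2) / t else 0))
      = (\<lambda>k. norm (x ^ k * (moebius_coeff t k *\<^sub>R 1)) / real (k + 1))"
  proof
    fix k
    have "\<bar>moebius_coeff t 0\<bar> = t"
      using t by (simp add: moebius_coeff_def diff_divide_distrib power2_eq_square)
    moreover have "\<bar>moebius_coeff t k\<bar> = (1 - t\<^sup>2) / t * t ^ k" if "k \<noteq> 0"
      using t t2 that by (simp add: moebius_coeff_def abs_mult)
    ultimately show "(1 - t\<^sup>2) / t * ((t * r) ^ k / real (k + 1)) + (if k = 0 then t - (1 - t\<^sup>2) / t else 0)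
      = norm (x ^ k * (moebius_coeff t k *\<^sub>R 1)) / real (k + 1)"
      by (cases "k = 0")
        (simp_all add: octonion_distrib octonion_norm_power norm_octonion_one x power_mult_distrib)
  qed
  also have "(1 - t\<^sup>2) / t * log_series (t * r) + (t - (1 - t\<^sup>2) / t)
      = t + (1 - t\<^sup>2) / t * (log_series (t * r) - 1)"
    by (simp only: right_diff_distrib)
  finally show ?thesis .
qed

text \<open>Subtracting \<open>t\<close> and multiplying by \<open>t / (1 - t)\<close> turns the
  inequality into \<open>(1 + t) * (log_series (t * r) - 1) > t\<close>. As \<open>t\<close> tends
  to 1, the difference of the sides tends to \<open>2 * log_series r - 3\<close>, which is positive
  beyond \<open>R1\<close>.\<close>

lemma moebius_bohr_sum_gt_1:
  assumes r: "R1 < r" "r < 1"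
  obtains t where "0 < t" "t < 1" "t + (1 - t\<^sup>2) / t * (log_series (t * r) - 1) > 1"
proof -
  have R1: "0 < R1" "log_series R1 = 3 / 2"
    using R1_bounds(1) by (auto simp: is_R1_iff)
  have "log_series r = - ln (1 - r) / r"
    using r R1 by (intro log_series_eq_ln) auto
  moreover have "log_series R1 < log_series r"
    using r R1 by (intro log_series_strict_mono) auto
  ultimately have L: "- ln (1 - r) / r > 3 / 2"
    using R1 by linarith
  \<comment> \<open>The closed form with \<open>ln\<close> reduces the limit to elementary
    continuity; \<open>log_series\<close> is restored once \<open>t\<close> is fixed.\<close>
  have "((\<lambda>t. (1 + t) * (- ln (1 - t * r) / (t * r) - 1) - t)
      \<longlongrightarrow> (1 + 1) * (- ln (1 - 1 * r) / (1 * r) - 1) - 1) (at_left (1::real))"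
    using r R1 by (intro tendsto_intros) auto
  then have "\<forall>\<^sub>F t in at_left 1. (1 + t) * (- ln (1 - t * r) / (t * r) - 1) - t > 0"
    by (rule order_tendstoD) (use L in simp)
  moreover have "\<forall>\<^sub>F t in at_left 1. t \<in> {0<..<1::real}"
    by (rule eventually_at_left_real) simp
  ultimately have "\<forall>\<^sub>F t in at_left 1. t \<in> {0<..<1::real} \<and>
      (1 + t) * (- ln (1 - t * r) / (t * r) - 1) - t > 0"
    by eventually_elim simp
  then obtain t where t: "0 < t" "t < 1"
    and gt: "(1 + t) * (- ln (1 - t * r) / (t * r) - 1) - t > 0"
    using eventually_happens by force
  have "0 < t * r" "t * r < 1"
    using t r R1 mult_strict_mono[of t 1 r 1] by auto
  with gt have gt: "t < (1 + t) * (log_series (t * r) - 1)"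
    by (simp add: log_series_eq_ln)
  have "1 - t = (1 - t) / t * t"
    using t by simp
  also have "\<dots> < (1 - t) / t * ((1 + t) * (log_series (t * r) - 1))"
    using gt t by (intro mult_strict_left_mono) auto
  also have "\<dots> = ((1 - t) * (1 + t)) / t * (log_series (t * r) - 1)"
    by simp
  also have "(1 - t) * (1 + t) = 1 - t\<^sup>2"
    by (simp add: power2_eq_square algebra_simps)
  finally show thesis
    using that t by simp
qed

theorem corollary2p2:
  shows "(\<exists>!y. is_R1 y) \<and> 0.5828 \<le> R1 \<and> R1 < 0.5829 \<and>
    (\<forall>f a x. f \<in> SRB \<longrightarrow> has_expansion f a \<longrightarrow> norm x \<le> R1 \<longrightarrow>
       summable (\<lambda>k. norm (x ^ k * a k) / real (k + 1)) \<and>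
       (\<Sum>k. norm (x ^ k * a k) / real (k + 1)) \<le> 1) \<and>
    (\<forall>r. R1 < r \<longrightarrow> r < 1 \<longrightarrow>
       (\<exists>f a. f \<in> SRB \<and> has_expansion f a \<and>
         (\<forall>x. norm x = r \<longrightarrow>
            summable (\<lambda>k. norm (x ^ k * a k) / real (k + 1)) \<and>
            (\<Sum>k. norm (x ^ k * a k) / real (k + 1)) > 1)))"
proof (intro conjI allI impI)
  show "\<exists>!y. is_R1 y" "0.5828 \<le> R1" "R1 < 0.5829"
    by (fact ex1_is_R1 R1_bounds)+
next
  fix f a and x :: octonion
  assume "f \<in> SRB" "has_expansion f a" "norm x \<le> R1"
  then show "summable (\<lambda>k. norm (x ^ k * a k) / real (k + 1))"
    "(\<Sum>k. norm (x ^ k * a k) / real (k + 1)) \<le> 1"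
    using bohr_inequality[of f a x] by (auto simp: SRB_def)
next
  fix r
  assume r: "R1 < r" "r < 1"
  obtain t where t: "0 < t" "t < 1" "t + (1 - t\<^sup>2) / t * (log_series (t * r) - 1) > 1"
    using moebius_bohr_sum_gt_1[OF r] .
  obtain f where f: "f \<in> SRB" "has_expansion f (\<lambda>k. moebius_coeff t k *\<^sub>R 1)"
    using moebius_SRB[OF t(1,2)] .
  have "0 \<le> r"
    using r R1_bounds(2) by simp
  from moebius_bohr_sums[OF t(1,2) this r(2)]
  show "\<exists>f a. f \<in> SRB \<and> has_expansion f a \<and>
      (\<forall>x. norm x = r \<longrightarrow>
        summable (\<lambda>k. norm (x ^ k * a k) / real (k + 1)) \<and>
        (\<Sum>k. norm (x ^ k * a k) / real (k + 1)) > 1)"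
    using f t(3) by (intro exI[of _ f] exI[of _ "\<lambda>k. moebius_coeff t k *\<^sub>R 1"]) (auto simp: sums_iff)
qed

end
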